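(* Let $0\le k<n$ be integers and let $\nu$ be a partition which is balanced as a straight shape with height and width both equal to $k$. (1) Let $\lambda:=\delta_n+\nu$. Then $[\varnothing,\lambda]_{\mathrm{shift}}$ is tCDE with $\mathbb{E}(\mathrm{uni}_{[\varnothing,\lambda]_{\mathrm{shift}}};\mathrm{ddeg})=\frac{n+1+k}{4}$. (2) Let $\lambda:=\delta_n+\nu+(n-1-k)^n$. Then $[\varnothing,\lambda]_{\mathrm{shift}}$ is tCDE with $\mathbb{E}(\mathrm{uni}_{[\varnothing,\lambda]_{\mathrm{shift}}};\mathrm{ddeg})=\frac{n}{2}$.
   Context: Partitions are weakly decreasing, eventually zero sequences of nonnegative integers; sums are componentwise: $(\mu+\nu)_i=\mu_i+\nu_i$. $\delta_n=(n,n-1,\ldots,1)$ and $b^a=(b,\ldots,b)$ ($a$ parts). A partition $\nu$ is balanced as a straight shape with height and width $k$ if $\ell(\nu)=\nu_1=k$ (or $\nu=\varnothing$ when $k=0$) and for every $1\le i\le k-1$ with $\nu_i>\nu_{i+1}$ one has $i+\nu_{i+1}=k$ (i.e., every outward corner of its Young diagram lies on the anti-diagonal of the $k\times k$ square). A strict partition has $\lambda_i>\lambda_{i+1}$ whenever $\lambda_i\neq 0$. The shifted Young's lattice is the set of strict partitions ordered by $\mu\subseteq\lambda$ iff $\mu_i\le\lambda_i$ for all $i$; $[\varnothing,\lambda]_{\mathrm{shift}}$ is its interval. It is a distributive lattice: $[\varnothing,\lambda]_{\mathrm{shift}}\cong J(P^{\mathrm{shift}}_\lambda)$, where $P^{\mathrm{shift}}_\lambda$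 is the set of boxes $[i,j]$ with $1\le i\le\ell(\lambda)$, $i\le j\le i+\lambda_i-1$, ordered by $[i,j]\le[i',j']$ iff $i\le i'$ and $j\le j'$, and $J(\cdot)$ denotes the lattice of order ideals. $\mathrm{ddeg}$ is the number of covered elements; $\mathrm{uni}$ is uniform. For $p\in P$ and order ideal $I$: $\mathcal{T}^+_p(I)=1$ iff $p\notin I$ and $p$ is minimal in $P\setminus I$; $\mathcal{T}^-_p(I)=1$ iff $p\in I$ and $p$ is maximal in $I$. A distribution $\mu$ on $J(P)$ is toggle-symmetric if $\mathbb{E}(\mu;\mathcal{T}^+_p)=\mathbb{E}(\mu;\mathcal{T}^-_p)$ for all $p$; $J(P)$ is tCDE if $\mathbb{E}(\mu;\mathrm{ddeg})=\mathbb{E}(\mathrm{uni}_{J(P)};\mathrm{ddeg})$ for every toggle-symmetric $\mu$. *)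

theory Defs
  imports Complex_Main
begin

text \<open>Partitions are encoded as functions nat => nat with 1-based indexing:
  the i-th part is nu i for i >= 1; the value at 0 is ignored.\<close>

definition is_partition :: "(nat \<Rightarrow> nat) \<Rightarrow> bool" where
  "is_partition nu \<longleftrightarrow> (\<forall>i\<ge>1. nu (Suc i) \<le> nu i) \<and> (\<exists>N. \<forall>i\<ge>N. nu i = 0)"

definition plen :: "(nat \<Rightarrow> nat) \<Rightarrow> nat" where
  "plen nu = card {i. 1 \<le> i \<and> 0 < nu i}"

definition is_strict_partition :: "(nat \<Rightarrow> nat) \<Rightarrow> bool" where
  "is_strict_partition lam \<longleftrightarrow> is_partition lam \<and>
     (\<forall>i\<ge>1. lam i \<noteq> 0 \<longrightarrow> lam (Suc i) < lam i)"

definition balanced :: "(nat \<Rightarrow> nat) \<Rightarrow> nat \<Rightarrow> bool" where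
  "balanced nu k \<longleftrightarrow> is_partition nu \<and> plen nu = k \<and> nu 1 = k \<and>
     (\<forall>i. 1 \<le> i \<and> i \<le> k - 1 \<and> nu (Suc i) < nu i \<longrightarrow> i + nu (Suc i) = k)"

definition staircase :: "nat \<Rightarrow> nat \<Rightarrow> nat" where
  "staircase n i = (if 1 \<le> i \<and> i \<le> n then n + 1 - i else 0)"

definition rect :: "nat \<Rightarrow> nat \<Rightarrow> nat \<Rightarrow> nat" where
  "rect b a i = (if 1 \<le> i \<and> i \<le> a then b else 0)"

definition padd :: "(nat \<Rightarrow> nat) \<Rightarrow> (nat \<Rightarrow> nat) \<Rightarrow> nat \<Rightarrow> nat" where
  "padd mu nu i = mu i + nu i"

definition shifted_boxes :: "(nat \<Rightarrow> nat) \<Rightarrow> (nat \<times> nat) set" where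
  "shifted_boxes lam = {(i, j). 1 \<le> i \<and> i \<le> plen lam \<and> i \<le> j \<and> j + 1 \<le> i + lam i}"

definition box_le :: "nat \<times> nat \<Rightarrow> nat \<times> nat \<Rightarrow> bool" where
  "box_le p q \<longleftrightarrow> fst p \<le> fst q \<and> snd p \<le> snd q"

text \<open>Finite posets are given by a carrier P and an order le.\<close>

definition order_ideals :: "'a set \<Rightarrow> ('a \<Rightarrow> 'a \<Rightarrow> bool) \<Rightarrow> 'a set set" where
  "order_ideals P le = {I. I \<subseteq> P \<and> (\<forall>x\<in>I. \<forall>y\<in>P. le y x \<longrightarrow> y \<in> I)}"

definition ddeg :: "'a set \<Rightarrow> ('a \<Rightarrow> 'a \<Rightarrow> bool) \<Rightarrow> 'a set \<Rightarrow> nat" where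
  "ddeg P le I = card {I' \<in> order_ideals P le. I' \<subset> I \<and>
      \<not> (\<exists>I''\<in>order_ideals P le. I' \<subset> I'' \<and> I'' \<subset> I)}"

definition tog_plus :: "'a set \<Rightarrow> ('a \<Rightarrow> 'a \<Rightarrow> bool) \<Rightarrow> 'a \<Rightarrow> 'a set \<Rightarrow> real" where
  "tog_plus P le p I = (if p \<in> P - I \<and> (\<forall>q\<in>P - I. le q p \<longrightarrow> q = p) then 1 else 0)"

definition tog_minus :: "'a set \<Rightarrow> ('a \<Rightarrow> 'a \<Rightarrow> bool) \<Rightarrow> 'a \<Rightarrow> 'a set \<Rightarrow> real" where
  "tog_minus P le p I = (if p \<in> I \<and> (\<forall>q\<in>I. le p q \<longrightarrow> q = p) then 1 else 0)"

definition is_distribution :: "'a set \<Rightarrow> ('a \<Rightarrow> 'a \<Rightarrow> bool) \<Rightarrow> ('a set \<Rightarrow> real) \<Rightarrow> bool" where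
  "is_distribution P le mu \<longleftrightarrow> (\<forall>I\<in>order_ideals P le. 0 \<le> mu I) \<and>
     (\<Sum>I\<in>order_ideals P le. mu I) = 1"

definition expect :: "'a set \<Rightarrow> ('a \<Rightarrow> 'a \<Rightarrow> bool) \<Rightarrow> ('a set \<Rightarrow> real) \<Rightarrow> ('a set \<Rightarrow> real) \<Rightarrow> real" where
  "expect P le mu f = (\<Sum>I\<in>order_ideals P le. mu I * f I)"

definition uni :: "'a set \<Rightarrow> ('a \<Rightarrow> 'a \<Rightarrow> bool) \<Rightarrow> 'a set \<Rightarrow> real" where
  "uni P le I = 1 / real (card (order_ideals P le))"

definition toggle_symmetric :: "'a set \<Rightarrow> ('a \<Rightarrow> 'a \<Rightarrow> bool) \<Rightarrow> ('a set \<Rightarrow> real) \<Rightarrow> bool" where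
  "toggle_symmetric P le mu \<longleftrightarrow>
     (\<forall>p\<in>P. expect P le mu (tog_plus P le p) = expect P le mu (tog_minus P le p))"

definition tCDE :: "'a set \<Rightarrow> ('a \<Rightarrow> 'a \<Rightarrow> bool) \<Rightarrow> bool" where
  "tCDE P le \<longleftrightarrow> (\<forall>mu. is_distribution P le mu \<and> toggle_symmetric P le mu \<longrightarrow>
     expect P le mu (\<lambda>I. real (ddeg P le I)) = expect P le (uni P le) (\<lambda>I. real (ddeg P le I)))"

end

theory Submission
  imports Defs
begin

text \<open>
  It suffices to write \<open>ddeg\<close>, pointwise on order ideals, as a constant plus a linear combination of
  the differences \<open>T\<^sup>-\<^sub>p - T\<^sup>+\<^sub>p\<close>: these have expectation zero under every toggle-symmetric
  distribution, and the uniform distribution is one of those. Reflect a shifted ideal in the diagonal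
  to obtain a symmetric Young diagram. On the boundary of a Young diagram the addable and removable
  boxes alternate, so weighting a box \<open>(a, b)\<close> by \<open>N + 2 - a - b\<close> makes the weights telescope to a
  constant. Every ideal has exactly one toggleable diagonal box, which yields the correction of the
  weight on the diagonal. Boxes that are addable in the whole quadrant but lie outside the shape do
  not spoil the identity, because balancedness puts them exactly where the weight vanishes: on
  \<open>a + b = N + 2\<close> off the diagonal and on \<open>a + b = N + 3\<close> on it. In case (1) \<open>N = n + k\<close>, in case (2)
  \<open>N = 2n - 1\<close>, and the constant is \<open>(N + 1) / 4\<close>.
\<close>

section \<open>Toggleable elements and down-degree in finite posets\<close>

definition addable :: "'a set \<Rightarrow> ('a \<Rightarrow> 'a \<Rightarrow> bool) \<Rightarrow> 'a set \<Rightarrow> 'a set" where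
  "addable P le I = {p \<in> P - I. \<forall>q\<in>P - I. le q p \<longrightarrow> q = p}"

definition removable :: "('a \<Rightarrow> 'a \<Rightarrow> bool) \<Rightarrow> 'a set \<Rightarrow> 'a set" where
  "removable le I = {p \<in> I. \<forall>q\<in>I. le p q \<longrightarrow> q = p}"

lemma tog_plus_addable: "tog_plus P le p I = of_bool (p \<in> addable P le I)"
  by (simp add: tog_plus_def addable_def)

lemma tog_minus_removable: "tog_minus P le p I = of_bool (p \<in> removable le I)"
  by (simp add: tog_minus_def removable_def)

lemma order_ideals_subset: "I \<in> order_ideals P le \<Longrightarrow> I \<subseteq> P"
  by (simp add: order_ideals_def)

lemma order_ideals_down:
  "I \<in> order_ideals P le \<Longrightarrow> x \<in> I \<Longrightarrow> y \<in> P \<Longrightarrow> le y x \<Longrightarrow> y \<in> I"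
  by (auto simp: order_ideals_def)

lemma finite_order_ideals: "finite P \<Longrightarrow> finite (order_ideals P le)"
  by (rule finite_subset[of _ "Pow P"]) (auto simp: order_ideals_def)

lemma empty_order_ideal: "{} \<in> order_ideals P le"
  by (simp add: order_ideals_def)

lemma order_ideal_remove:
  assumes "I \<in> order_ideals P le" "p \<in> removable le I"
  shows "I - {p} \<in> order_ideals P le"
  using assms unfolding order_ideals_def removable_def by blast

lemma order_ideal_insert:
  assumes "I \<in> order_ideals P le" "p \<in> addable P le I"
  shows "insert p I \<in> order_ideals P le"
  using assms unfolding order_ideals_def addable_def by blast

text \<open>Take \<open>p\<close> maximal in \<open>I - I'\<close>. A different element of
  \<open>I\<close> above \<open>p\<close> would lie in \<open>I'\<close>, and down-closure would
  pull \<open>p\<close> into \<open>I'\<close>.\<close>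

lemma exists_removable_outside:
  assumes "finite I" and "transp le" and "antisymp le"
    and "I \<in> order_ideals P le" "I' \<in> order_ideals P le" "I' \<subset> I"
  shows "\<exists>p \<in> removable le I. p \<notin> I'"
proof -
  let ?lt = "\<lambda>x y. le x y \<and> x \<noteq> y"
  have "asymp_on (I - I') ?lt"
    using assms(3) by (auto intro!: asymp_onI dest: antisympD)
  moreover have "transp_on (I - I') ?lt"
    using assms(2,3) by (intro transp_onI) (blast dest: antisympD transpD)
  ultimately obtain p where p: "p \<in> I - I'" "\<forall>x\<in>I - I'. x \<noteq> p \<longrightarrow> \<not> ?lt p x"
    using Finite_Set.bex_max_element[of "I - I'" ?lt] assms(1,6) by blast
  have "q = p" if "q \<in> I" "le p q" for q
  proof (rule ccontr)
    assume "q \<noteq> p"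
    with p that have "q \<in> I'" by blast
    then have "p \<in> I'"
      using p(1) that order_ideals_down[OF assms(5)] order_ideals_subset[OF assms(4)] by blast
    with p(1) show False by simp
  qed
  with p(1) show ?thesis by (auto simp: removable_def)
qed

text \<open>The ideals covered by \<open>I\<close> are exactly the sets \<open>I - {p}\<close> with
  \<open>p\<close> maximal in \<open>I\<close>: any smaller ideal misses some such \<open>p\<close>
  and hence lies inside \<open>I - {p}\<close>.\<close>

lemma ddeg_eq_card_removable:
  assumes "finite P" and "transp le" and "antisymp le" and I: "I \<in> order_ideals P le"
  shows "ddeg P le I = card (removable le I)"
proof -
  let ?C = "{I' \<in> order_ideals P le. I' \<subset> I \<and>
      \<not> (\<exists>I''\<in>order_ideals P le. I' \<subset> I'' \<and> I'' \<subset> I)}"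
  have finI: "finite I" using assms(1) order_ideals_subset[OF I] finite_subset by blast
  have "?C = (\<lambda>p. I - {p}) ` removable le I"
  proof (intro equalityI subsetI)
    fix I' assume "I' \<in> ?C"
    then have I': "I' \<in> order_ideals P le" "I' \<subset> I"
      and cover: "\<not> (\<exists>I''\<in>order_ideals P le. I' \<subset> I'' \<and> I'' \<subset> I)" by simp_all
    obtain p where p: "p \<in> removable le I" "p \<notin> I'"
      using exists_removable_outside[OF finI assms(2,3) I I'] by blast
    have "I - {p} \<subset> I" using p(1) by (auto simp: removable_def)
    then have "\<not> I' \<subset> I - {p}" using cover order_ideal_remove[OF I p(1)] by blast
    with I'(2) p(2) have "I' = I - {p}" by blast
    with p(1) show "I' \<in> (\<lambda>p. I - {p}) ` removable le I" by blast
  next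
    fix I' assume "I' \<in> (\<lambda>p. I - {p}) ` removable le I"
    then obtain p where p: "p \<in> removable le I" "I' = I - {p}" by blast
    then have "p \<in> I" by (simp add: removable_def)
    with p order_ideal_remove[OF I p(1)] show "I' \<in> ?C" by blast
  qed
  moreover have "inj_on (\<lambda>p. I - {p}) (removable le I)"
    by (rule inj_onI) (auto simp: removable_def)
  ultimately show ?thesis by (simp add: ddeg_def card_image)
qed

section \<open>Toggle symmetry of the uniform distribution and certificates for tCDE\<close>

text \<open>Inserting \<open>p\<close> and deleting \<open>p\<close> are mutually inverse maps
  between the two families of ideals.\<close>

lemma card_addable_eq_card_removable:
  assumes "p \<in> P"
  shows "card {I \<in> order_ideals P le. p \<in> addable P le I}
    = card {I \<in> order_ideals P le. p \<in> removable le I}"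
proof (rule bij_betw_same_card[of "insert p"],
    rule bij_betw_byWitness[where f' = "\<lambda>I. I - {p}"])
  show "insert p ` {I \<in> order_ideals P le. p \<in> addable P le I}
      \<subseteq> {I \<in> order_ideals P le. p \<in> removable le I}"
  proof (rule image_subsetI)
    fix I assume "I \<in> {I \<in> order_ideals P le. p \<in> addable P le I}"
    then have I: "I \<in> order_ideals P le" "p \<in> addable P le I" by auto
    then have "p \<in> removable le (insert p I)"
      using assms order_ideals_down[OF I(1)] by (auto simp: addable_def removable_def)
    with order_ideal_insert[OF I]
    show "insert p I \<in> {I \<in> order_ideals P le. p \<in> removable le I}" by simp
  qed
  show "(\<lambda>I. I - {p}) ` {I \<in> order_ideals P le. p \<in> removable le I}
      \<subseteq> {I \<in> order_ideals P le. p \<in> addable P le I}"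
  proof (rule image_subsetI)
    fix I assume "I \<in> {I \<in> order_ideals P le. p \<in> removable le I}"
    then have I: "I \<in> order_ideals P le" "p \<in> removable le I" by auto
    then have "p \<in> addable P le (I - {p})"
      using assms order_ideals_down[OF I(1)] by (auto simp: addable_def removable_def)
    with order_ideal_remove[OF I]
    show "I - {p} \<in> {I \<in> order_ideals P le. p \<in> addable P le I}" by simp
  qed
qed (auto simp: addable_def removable_def)

lemma toggle_symmetric_uni:
  assumes "finite P"
  shows "toggle_symmetric P le (uni P le)"
  unfolding toggle_symmetric_def
proof
  fix p assume "p \<in> P"
  have "expect P le (uni P le) (\<lambda>I. of_bool (Q I))
      = real (card {I \<in> order_ideals P le. Q I}) / real (card (order_ideals P le))" for Q
    by (simp add: expect_def uni_def sum_divide_distrib[symmetric] finite_order_ideals[OF assms]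
        Collect_conj_eq)
  then show "expect P le (uni P le) (tog_plus P le p) = expect P le (uni P le) (tog_minus P le p)"
    using card_addable_eq_card_removable[OF \<open>p \<in> P\<close>]
    by (simp add: tog_plus_addable[abs_def] tog_minus_removable[abs_def])
qed

lemma is_distribution_uni: "finite P \<Longrightarrow> is_distribution P le (uni P le)"
  using finite_order_ideals[of P le] empty_order_ideal[of P le]
  by (auto simp: is_distribution_def uni_def card_gt_0_iff)

text \<open>The weights \<open>c\<close> do not depend on the ideal, so expectation commutes with
  the sum over \<open>P\<close> and toggle symmetry kills each term. The uniform distribution is one
  instance, which identifies its expectation as \<open>K\<close>.\<close>

lemma tCDE_if_toggle_certificate:
  fixes c :: "'a \<Rightarrow> real" and K :: real
  assumes "finite P"
    and cert: "\<And>I. I \<in> order_ideals P le \<Longrightarrow>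
      real (ddeg P le I) = K + (\<Sum>p\<in>P. c p * (tog_minus P le p I - tog_plus P le p I))"
  shows "tCDE P le" "expect P le (uni P le) (\<lambda>I. real (ddeg P le I)) = K"
proof -
  have *: "expect P le mu (\<lambda>I. real (ddeg P le I)) = K"
    if "is_distribution P le mu" "toggle_symmetric P le mu" for mu
  proof -
    have "expect P le mu (\<lambda>I. real (ddeg P le I)) =
        (\<Sum>I\<in>order_ideals P le. mu I * K
          + (\<Sum>p\<in>P. c p * (mu I * tog_minus P le p I - mu I * tog_plus P le p I)))"
      unfolding expect_def
      by (rule sum.cong) (simp_all add: cert algebra_simps sum_distrib_left)
    also have "\<dots> = (\<Sum>I\<in>order_ideals P le. mu I) * K
        + (\<Sum>p\<in>P. c p * (expect P le mu (tog_minus P le p) - expect P le mu (tog_plus P le p)))"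
      unfolding expect_def sum.distrib sum_distrib_right
      by (subst sum.swap) (simp add: sum_distrib_left[symmetric] sum_subtractf[symmetric])
    also have "\<dots> = K"
      using that by (simp add: is_distribution_def toggle_symmetric_def)
    finally show ?thesis .
  qed
  show "expect P le (uni P le) (\<lambda>I. real (ddeg P le I)) = K"
    using * assms(1) is_distribution_uni toggle_symmetric_uni by blast
  with * show "tCDE P le" by (simp add: tCDE_def)
qed

section \<open>Addable and removable boxes of straight and shifted diagrams\<close>

text \<open>Infinite ambient posets: their finite order ideals are the Young diagrams and the
  shifted diagrams. Measuring addability here, and not inside a fixed shape, keeps the whole
  boundary of a diagram visible.\<close>

definition quadrant :: "(nat \<times> nat) set" where
  "quadrant = {(a, b). 1 \<le> a \<and> 1 \<le> b}"

definition shifted_quadrant :: "(nat \<times> nat) set" where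
  "shifted_quadrant = {(a, b). 1 \<le> a \<and> a \<le> b}"

lemma transp_box_le: "transp box_le"
  by (auto simp: transp_def box_le_def)

lemma antisymp_box_le: "antisymp box_le"
  by (auto simp: antisymp_on_def box_le_def)

lemma quadrant_ideal_down:
  assumes "D \<in> order_ideals quadrant box_le" "(a, b) \<in> D" "1 \<le> a'" "a' \<le> a" "1 \<le> b'" "b' \<le> b"
  shows "(a', b') \<in> D"
  using order_ideals_down[OF assms(1,2), of "(a', b')"] assms(3-)
  by (simp add: quadrant_def box_le_def)

lemma shifted_ideal_down:
  assumes "I \<in> order_ideals shifted_quadrant box_le" "(a, b) \<in> I"
    "1 \<le> a'" "a' \<le> a" "a' \<le> b'" "b' \<le> b"
  shows "(a', b') \<in> I"
  using order_ideals_down[OF assms(1,2), of "(a', b')"] assms(3-)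
  by (simp add: shifted_quadrant_def box_le_def)

text \<open>Every box strictly below \<open>(a, b)\<close> lies below one of its two neighbours, so
  by down-closure of \<open>D\<close> minimality need only be tested there.\<close>

lemma mem_addable_quadrant:
  assumes D: "D \<in> order_ideals quadrant box_le"
  shows "(a, b) \<in> addable quadrant box_le D \<longleftrightarrow> 1 \<le> a \<and> 1 \<le> b \<and> (a, b) \<notin> D \<and>
    (a = 1 \<or> (a - 1, b) \<in> D) \<and> (b = 1 \<or> (a, b - 1) \<in> D)" (is "?L \<longleftrightarrow> ?R")
proof
  assume ?L
  then have ab: "1 \<le> a" "1 \<le> b" "(a, b) \<notin> D" by (auto simp: addable_def quadrant_def)
  have least: "q = (a, b)" if "q \<in> quadrant - D" "box_le q (a, b)" for q
    using \<open>?L\<close> that unfolding addable_def by blast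
  have "a = 1 \<or> (a - 1, b) \<in> D"
    using ab least[of "(a - 1, b)"] by (cases "1 < a") (force simp: quadrant_def box_le_def)+
  moreover have "b = 1 \<or> (a, b - 1) \<in> D"
    using ab least[of "(a, b - 1)"] by (cases "1 < b") (force simp: quadrant_def box_le_def)+
  ultimately show ?R using ab by blast
next
  assume R: ?R
  have "(x, y) = (a, b)" if "1 \<le> x" "1 \<le> y" "(x, y) \<notin> D" "x \<le> a" "y \<le> b" for x y
  proof (rule ccontr)
    assume "(x, y) \<noteq> (a, b)"
    with that have "x \<le> a - 1 \<and> a \<noteq> 1 \<or> y \<le> b - 1 \<and> b \<noteq> 1" by auto
    with R that quadrant_ideal_down[OF D, of "a - 1" b x y] quadrant_ideal_down[OF D, of a "b - 1" x y]
    show False by blast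
  qed
  with R show ?L by (auto simp: addable_def quadrant_def box_le_def)
qed

lemma mem_removable_quadrant:
  assumes D: "D \<in> order_ideals quadrant box_le"
  shows "(a, b) \<in> removable box_le D \<longleftrightarrow> (a, b) \<in> D \<and> (Suc a, b) \<notin> D \<and> (a, Suc b) \<notin> D"
    (is "?L \<longleftrightarrow> ?R")
proof
  assume ?L then show ?R by (force simp: removable_def box_le_def)
next
  assume R: ?R
  then have pos: "1 \<le> a" "1 \<le> b" using order_ideals_subset[OF D] by (auto simp: quadrant_def)
  have "(x, y) = (a, b)" if "(x, y) \<in> D" "a \<le> x" "b \<le> y" for x y
  proof (rule ccontr)
    assume "(x, y) \<noteq> (a, b)"
    with that have "Suc a \<le> x \<or> Suc b \<le> y" by auto
    with R pos that quadrant_ideal_down[OF D, of x y "Suc a" b]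
      quadrant_ideal_down[OF D, of x y a "Suc b"]
    show False by auto
  qed
  with R show ?L by (auto simp: removable_def box_le_def)
qed

text \<open>As in the quadrant, except that a diagonal box has no left neighbour in the shifted
  quadrant, which leaves only the box above it.\<close>

lemma mem_addable_shifted:
  assumes I: "I \<in> order_ideals shifted_quadrant box_le"
  shows "(a, b) \<in> addable shifted_quadrant box_le I \<longleftrightarrow> 1 \<le> a \<and> a \<le> b \<and> (a, b) \<notin> I \<and>
    (a = 1 \<or> (a - 1, b) \<in> I) \<and> (a = b \<or> (a, b - 1) \<in> I)" (is "?L \<longleftrightarrow> ?R")
proof
  assume ?L
  then have ab: "1 \<le> a" "a \<le> b" "(a, b) \<notin> I" by (auto simp: addable_def shifted_quadrant_def)
  have least: "q = (a, b)" if "q \<in> shifted_quadrant - I" "box_le q (a, b)" for q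
    using \<open>?L\<close> that unfolding addable_def by blast
  have "a = 1 \<or> (a - 1, b) \<in> I"
    using ab least[of "(a - 1, b)"] by (cases "1 < a") (force simp: shifted_quadrant_def box_le_def)+
  moreover have "a = b \<or> (a, b - 1) \<in> I"
    using ab least[of "(a, b - 1)"] by (cases "a < b") (force simp: shifted_quadrant_def box_le_def)+
  ultimately show ?R using ab by blast
next
  assume R: ?R
  have "(x, y) = (a, b)" if "1 \<le> x" "x \<le> y" "(x, y) \<notin> I" "x \<le> a" "y \<le> b" for x y
  proof (rule ccontr)
    assume "(x, y) \<noteq> (a, b)"
    with that have "x \<le> a - 1 \<and> a \<noteq> 1 \<or> x = a \<and> y \<le> b - 1 \<and> a \<noteq> b" by auto
    with R that shifted_ideal_down[OF I, of "a - 1" b x y] shifted_ideal_down[OF I, of a "b - 1" x y]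
    show False by blast
  qed
  with R show ?L by (auto simp: addable_def shifted_quadrant_def box_le_def)
qed

lemma mem_removable_shifted:
  assumes I: "I \<in> order_ideals shifted_quadrant box_le"
  shows "(a, b) \<in> removable box_le I \<longleftrightarrow>
    (a, b) \<in> I \<and> (a = b \<or> (Suc a, b) \<notin> I) \<and> (a, Suc b) \<notin> I"
    (is "?L \<longleftrightarrow> ?R")
proof
  assume ?L then show ?R by (force simp: removable_def box_le_def)
next
  assume R: ?R
  then have pos: "1 \<le> a" "a \<le> b"
    using order_ideals_subset[OF I] by (auto simp: shifted_quadrant_def)
  have "(x, y) = (a, b)" if "(x, y) \<in> I" "a \<le> x" "b \<le> y" for x y
  proof (rule ccontr)
    assume "(x, y) \<noteq> (a, b)"
    moreover have "x \<le> y"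
      using that(1) order_ideals_subset[OF I] by (auto simp: shifted_quadrant_def)
    ultimately have "Suc a \<le> x \<and> a \<noteq> b \<or> Suc b \<le> y" using that by auto
    with R pos that shifted_ideal_down[OF I, of x y "Suc a" b]
      shifted_ideal_down[OF I, of x y a "Suc b"]
    show False by auto
  qed
  with R show ?L by (auto simp: removable_def box_le_def)
qed

text \<open>Walking along the boundary of a Young diagram, addable and removable boxes alternate, and
  the addable box following a removable box in row \<open>a\<close> lies in row \<open>a + 1\<close>.\<close>

lemma fst_addable_quadrant:
  assumes D: "D \<in> order_ideals quadrant box_le" and fin: "finite D"
  shows "fst ` addable quadrant box_le D = insert 1 (Suc ` fst ` removable box_le D)"
    (is "fst ` ?A = insert 1 (Suc ` fst ` ?R)")
proof -
  have row_fin: "finite {b. (a, b) \<in> D}" for a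
    by (rule finite_subset[OF _ finite_imageI[OF fin, of snd]]) force
  have addable_in_row: "\<exists>b'. (a, b') \<in> ?A \<and> 1 \<le> b'"
    if "1 \<le> a" "1 \<le> b" "(a, b) \<notin> D" "a = 1 \<or> (a - 1, b) \<in> D" for a b
  proof -
    \<comment> \<open>The first free column of row \<open>a\<close>. The box above it is present
      because row \<open>a - 1\<close> reaches \<open>b\<close> and
      \<open>b' \<le> b\<close>.\<close>
    define b' where "b' = (LEAST b. 1 \<le> b \<and> (a, b) \<notin> D)"
    have b': "1 \<le> b'" "(a, b') \<notin> D" "b' \<le> b"
      using LeastI[of "\<lambda>b. 1 \<le> b \<and> (a, b) \<notin> D" b] Least_le[of "\<lambda>b. 1 \<le> b \<and> (a, b) \<notin> D" b] that
      unfolding b'_def by auto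
    have "b' = 1 \<or> (a, b' - 1) \<in> D"
      using not_less_Least[of "b' - 1" "\<lambda>b. 1 \<le> b \<and> (a, b) \<notin> D"] b'(1)
      unfolding b'_def[symmetric] by fastforce
    moreover have "a = 1 \<or> (a - 1, b') \<in> D"
      using that b' quadrant_ideal_down[OF D, of "a - 1" b "a - 1" b'] by fastforce
    ultimately show ?thesis using that b' mem_addable_quadrant[OF D] by blast
  qed
  have "1 \<in> fst ` ?A"
  proof -
    \<comment> \<open>Adjoining 0 to the finite set of occupied columns forces the fresh column to
      be positive.\<close>
    obtain b where "1 \<le> b" "(1, b) \<notin> D"
      using ex_new_if_finite[OF _ finite.insertI[OF row_fin[of 1], of 0]] by fastforce
    from addable_in_row[OF _ this] show ?thesis by (metis fst_conv image_eqI le_refl)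
  qed
  moreover have "Suc a \<in> fst ` ?A" if "(a, b) \<in> ?R" for a b
  proof -
    have "(a, b) \<in> D" "(Suc a, b) \<notin> D" using that mem_removable_quadrant[OF D] by auto
    moreover have "1 \<le> b" using calculation(1) order_ideals_subset[OF D] by (auto simp: quadrant_def)
    ultimately show ?thesis
      using addable_in_row[of "Suc a" b] by (metis diff_Suc_1 fst_conv image_eqI le_add1 plus_1_eq_Suc)
  qed
  moreover have "a \<in> Suc ` fst ` ?R" if "(a, b) \<in> ?A" "a \<noteq> 1" for a b
  proof -
    have ab: "1 \<le> a" "1 \<le> b" "(a, b) \<notin> D" "(a - 1, b) \<in> D"
      using that mem_addable_quadrant[OF D] by auto
    \<comment> \<open>The last box of row \<open>a - 1\<close> is removable: row \<open>a\<close>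
      already stops before column \<open>b\<close>, and \<open>b \<le> b'\<close>.\<close>
    define b' where "b' = Max {b. (a - 1, b) \<in> D}"
    have b': "(a - 1, b') \<in> D" "b \<le> b'"
      using Max_in[OF row_fin[of "a - 1"]] Max_ge[OF row_fin[of "a - 1"]] ab(4)
      unfolding b'_def by blast+
    have "(a - 1, Suc b') \<notin> D"
      using Max_ge[OF row_fin[of "a - 1"], of "Suc b'"] unfolding b'_def[symmetric] by auto
    moreover have "(a, b') \<notin> D"
      using quadrant_ideal_down[OF D, of a b' a b] ab b' by auto
    ultimately have "(a - 1, b') \<in> ?R" using mem_removable_quadrant[OF D] b' ab by simp
    then show ?thesis using ab(1) by (force simp: image_iff)
  qed
  ultimately have "fst ` ?A \<subseteq> insert 1 (Suc ` fst ` ?R)" "insert 1 (Suc ` fst ` ?R) \<subseteq> fst ` ?A"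
    by force+
  then show ?thesis by (rule equalityI)
qed

text \<open>Two boxes of one row are comparable, whereas distinct minimal elements of a set are not.
  This lets sums over addable boxes be reindexed by rows.\<close>

lemma inj_on_fst_addable: "inj_on fst (addable P box_le I)"
proof (rule inj_onI)
  fix p q assume "p \<in> addable P box_le I" "q \<in> addable P box_le I" "fst p = fst q"
  moreover from this(3) have "box_le p q \<or> box_le q p" by (auto simp: box_le_def)
  ultimately show "p = q" unfolding addable_def by blast
qed

lemma inj_on_fst_removable: "inj_on fst (removable box_le I)"
proof (rule inj_onI)
  fix p q assume "p \<in> removable box_le I" "q \<in> removable box_le I" "fst p = fst q"
  moreover from this(3) have "box_le p q \<or> box_le q p" by (auto simp: box_le_def)
  ultimately show "p = q" unfolding removable_def by blast
qed

text \<open>Alternation in summed form: apart from the addable box in row 1, each addable box is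
  paired with the removable box in the row above it. The choices \<open>f = 1\<close> and
  \<open>f = real\<close> are the ones needed later.\<close>

lemma sum_fst_addable_quadrant:
  fixes f :: "nat \<Rightarrow> real"
  assumes D: "D \<in> order_ideals quadrant box_le" and fin: "finite D"
  shows "(\<Sum>p\<in>addable quadrant box_le D. f (fst p))
    = f 1 + (\<Sum>p\<in>removable box_le D. f (Suc (fst p)))"
proof -
  have finR: "finite (removable box_le D)"
    by (rule finite_subset[OF _ fin]) (auto simp: removable_def)
  \<comment> \<open>Row indices start at 1, so row 1 is not the successor of a row with a removable
    box and its term splits off.\<close>
  have "0 \<notin> fst ` removable box_le D"
    using order_ideals_subset[OF D] by (force simp: removable_def quadrant_def)
  then have notin: "1 \<notin> Suc ` fst ` removable box_le D" by auto
  have "(\<Sum>p\<in>addable quadrant box_le D. f (fst p)) = sum f (fst ` addable quadrant box_le D)"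
    by (simp add: sum.reindex[OF inj_on_fst_addable])
  also have "\<dots> = f 1 + sum f (Suc ` fst ` removable box_le D)"
    unfolding fst_addable_quadrant[OF D fin] using finR notin by (subst sum.insert) auto
  also have "sum f (Suc ` fst ` removable box_le D) = (\<Sum>p\<in>removable box_le D. f (Suc (fst p)))"
    by (simp add: sum.reindex inj_on_fst_removable)
  finally show ?thesis .
qed

section \<open>Reflection in the diagonal\<close>

definition double :: "(nat \<times> nat) set \<Rightarrow> (nat \<times> nat) set" where
  "double I = I \<union> prod.swap ` I"

lemma mem_double: "(a, b) \<in> double I \<longleftrightarrow> (a, b) \<in> I \<or> (b, a) \<in> I"
  by (auto simp: double_def)

lemma double_order_ideal:
  assumes I: "I \<in> order_ideals shifted_quadrant box_le"
  shows "double I \<in> order_ideals quadrant box_le"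
proof -
  have sub: "1 \<le> a \<and> a \<le> b" if "(a, b) \<in> I" for a b
    using that order_ideals_subset[OF I] by (auto simp: shifted_quadrant_def)
  have down: "(a', b') \<in> double I"
    if "(a, b) \<in> I" "1 \<le> a'" "1 \<le> b'" "a' \<le> a" "b' \<le> b" for a b a' b'
    using that sub[OF that(1)] shifted_ideal_down[OF I that(1), of a' b']
      shifted_ideal_down[OF I that(1), of b' a'] by (cases "a' \<le> b'") (auto simp: mem_double)
  have "(y1, y2) \<in> double I"
    if "(x1, x2) \<in> double I" "1 \<le> y1" "1 \<le> y2" "y1 \<le> x1" "y2 \<le> x2" for x1 x2 y1 y2
    using that down[of x1 x2 y1 y2] down[of x2 x1 y2 y1] by (auto simp: mem_double)
  moreover have "double I \<subseteq> quadrant" using sub by (fastforce simp: double_def quadrant_def)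
  ultimately show ?thesis by (auto simp: order_ideals_def quadrant_def box_le_def)
qed

text \<open>By symmetry it suffices to look at \<open>a \<le> b\<close>. Off the diagonal the upper
  and left neighbours of \<open>(a, b)\<close> again lie on or above the diagonal; on it they are
  mirror images of each other, so both tests amount to the single shifted one.\<close>

lemma addable_double:
  assumes I: "I \<in> order_ideals shifted_quadrant box_le"
  shows "addable quadrant box_le (double I) = double (addable shifted_quadrant box_le I)"
proof -
  have sub: "a \<le> b" if "(a, b) \<in> I" for a b
    using that order_ideals_subset[OF I] by (auto simp: shifted_quadrant_def)
  have upper: "(a, b) \<in> addable quadrant box_le (double I)
      \<longleftrightarrow> (a, b) \<in> addable shifted_quadrant box_le I" if "a \<le> b" for a b
  proof (cases "a = b")
    case True
    then show ?thesis using sub[of a "a - 1"]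
      unfolding mem_addable_quadrant[OF double_order_ideal[OF I]] mem_addable_shifted[OF I] mem_double
      by auto
  next
    case False
    then show ?thesis using that sub[of b a] sub[of b "a - 1"] sub[of "b - 1" a]
      unfolding mem_addable_quadrant[OF double_order_ideal[OF I]] mem_addable_shifted[OF I] mem_double
      by (cases "b = a + 1") auto
  qed
  have swap: "(a, b) \<in> addable quadrant box_le (double I)
      \<longleftrightarrow> (b, a) \<in> addable quadrant box_le (double I)" for a b
    unfolding mem_addable_quadrant[OF double_order_ideal[OF I]] mem_double by blast
  have "(a, b) \<in> addable quadrant box_le (double I) \<longleftrightarrow>
      (a, b) \<in> double (addable shifted_quadrant box_le I)" for a b
    unfolding mem_double
    using upper[of a b] upper[of b a] swap[of a b] linear[of a b] mem_addable_shifted[OF I]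
    by blast
  then show ?thesis by auto
qed

lemma removable_double:
  assumes I: "I \<in> order_ideals shifted_quadrant box_le"
  shows "removable box_le (double I) = double (removable box_le I)"
proof -
  have sub: "a \<le> b" if "(a, b) \<in> I" for a b
    using that order_ideals_subset[OF I] by (auto simp: shifted_quadrant_def)
  have upper: "(a, b) \<in> removable box_le (double I)
      \<longleftrightarrow> (a, b) \<in> removable box_le I" if "a \<le> b" for a b
  proof -
    \<comment> \<open>A box \<open>(b, Suc a)\<close> of \<open>I\<close> has
      \<open>b \<le> Suc a\<close>, so \<open>b\<close> is \<open>a\<close> or \<open>Suc a\<close>;
      in the latter case it coincides with \<open>(Suc a, b)\<close>.\<close>
    have "(b, Suc a) \<in> I \<longrightarrow> a = b \<or> (Suc a, b) \<in> I"
      using that sub[of b "Suc a"] by (cases "b = Suc a") auto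
    then show ?thesis
      using that sub[of b a] sub[of "Suc b" a] sub[of "Suc a" b]
      unfolding mem_removable_quadrant[OF double_order_ideal[OF I]] mem_removable_shifted[OF I]
        mem_double
      by (cases "b = a") auto
  qed
  have swap: "(a, b) \<in> removable box_le (double I)
      \<longleftrightarrow> (b, a) \<in> removable box_le (double I)" for a b
    unfolding mem_removable_quadrant[OF double_order_ideal[OF I]] mem_double by blast
  have "(a, b) \<in> removable box_le (double I) \<longleftrightarrow> (a, b) \<in> double (removable box_le I)" for a b
    unfolding mem_double
    using upper[of a b] upper[of b a] swap[of a b] linear[of a b] mem_removable_shifted[OF I] sub
    by blast
  then show ?thesis by auto
qed

lemma sum_double:
  fixes f :: "nat \<times> nat \<Rightarrow> real"
  assumes "finite X" "X \<subseteq> shifted_quadrant"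
  shows "(\<Sum>p\<in>double X. f p)
    = (\<Sum>p\<in>X. if fst p = snd p then f p else f p + f (prod.swap p))"
proof -
  let ?Y = "{p \<in> X. fst p \<noteq> snd p}"
  have "double X = X \<union> prod.swap ` ?Y" by (force simp: double_def)
  moreover have "X \<inter> prod.swap ` ?Y = {}" 
  proof -
    have "(b, a) \<notin> X" if "(a, b) \<in> X" "a \<noteq> b" for a b
      using subsetD[OF assms(2), of "(a, b)"] subsetD[OF assms(2), of "(b, a)"] that
      by (auto simp: shifted_quadrant_def)
    then show ?thesis by auto
  qed
  ultimately have "(\<Sum>p\<in>double X. f p) = sum f X + sum f (prod.swap ` ?Y)"
    using assms(1) by (simp add: sum.union_disjoint)
  also have "sum f (prod.swap ` ?Y) = (\<Sum>p\<in>?Y. f (prod.swap p))"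
    by (subst sum.reindex) (auto intro: inj_onI)
  also have "\<dots> = (\<Sum>p\<in>X. if fst p = snd p then 0 else f (prod.swap p))"
    using assms(1) by (simp add: sum.inter_filter if_distrib cong: if_cong) (rule sum.cong, auto)
  finally show ?thesis by (simp add: sum.distrib[symmetric]) (rule sum.cong, auto)
qed

text \<open>Only the box ending the diagonal of the ideal and the next diagonal box can be toggled, and
  which of the two it is depends on the box above the latter.\<close>

lemma card_diagonal_toggles:
  assumes I: "I \<in> order_ideals shifted_quadrant box_le" and fin: "finite I"
  shows "card {p \<in> addable shifted_quadrant box_le I. fst p = snd p}
    + card {p \<in> removable box_le I. fst p = snd p} = 1" (is "card ?A + card ?R = 1")
proof -
  have "finite {a. (a, a) \<in> I}"
    by (rule finite_subset[OF _ finite_imageI[OF fin, of snd]]) force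
  from ex_new_if_finite[OF _ finite.insertI[OF this, of 0]]
  obtain x where x: "(x, x) \<notin> I" "x \<noteq> 0" by fastforce
  \<comment> \<open>The number of diagonal boxes of \<open>I\<close>. Writing \<open>Suc m\<close>
    avoids the index 0, where \<open>(0, 0)\<close> is trivially absent.\<close>
  define m where "m = (LEAST m. (Suc m, Suc m) \<notin> I)"
  have m: "(Suc m, Suc m) \<notin> I"
    unfolding m_def using x LeastI[of "\<lambda>m. (Suc m, Suc m) \<notin> I" "x - 1"] by simp
  have below: "(a, a) \<in> I \<longleftrightarrow> 1 \<le> a \<and> a \<le> m" for a
  proof
    assume a: "(a, a) \<in> I"
    then have "1 \<le> a" using order_ideals_subset[OF I] by (auto simp: shifted_quadrant_def)
    moreover have "\<not> Suc m \<le> a" using shifted_ideal_down[OF I a, of "Suc m" "Suc m"] m by auto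
    ultimately show "1 \<le> a \<and> a \<le> m" by simp
  next
    assume "1 \<le> a \<and> a \<le> m"
    then show "(a, a) \<in> I" using not_less_Least[of "a - 1" "\<lambda>m. (Suc m, Suc m) \<notin> I"]
      unfolding m_def[symmetric] by (cases a) auto
  qed
  have up: "(a, Suc a) \<in> I" if "1 \<le> a" "a < m" for a
    using shifted_ideal_down[OF I, of m m a "Suc a"] below[of m] that by auto
  have above: "(a, Suc a) \<in> I \<Longrightarrow> (a, a) \<in> I" for a
    using shifted_ideal_down[OF I, of a "Suc a" a a] order_ideals_subset[OF I]
    by (auto simp: shifted_quadrant_def)
  \<comment> \<open>For \<open>m = 0\<close> the next diagonal box is \<open>(1, 1)\<close>, which
    has no box above it and is always addable.\<close>
  define C where "C \<longleftrightarrow> m = 0 \<or> (m, Suc m) \<in> I"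
  have A: "(a, a) \<in> addable shifted_quadrant box_le I \<longleftrightarrow> a = Suc m \<and> C" for a
    unfolding mem_addable_shifted[OF I] below C_def using above[of "a - 1"] below[of "a - 1"]
    by (cases "a = Suc m") (auto simp: not_less_eq_eq)
  have R: "(a, a) \<in> removable box_le I \<longleftrightarrow> a = m \<and> \<not> C" for a
    unfolding mem_removable_shifted[OF I] below C_def using up[of a] by (cases "a = m") auto
  have diag: "{p \<in> X. fst p = snd p} = (\<lambda>a. (a, a)) ` {a. (a, a) \<in> X}" for X :: "(nat \<times> nat) set"
    by force
  show ?thesis unfolding diag A R by (cases C) simp_all
qed

text \<open>Twice \<open>N + 2 - a - b\<close> because an off-diagonal box occurs twice in the doubled diagram; the
  diagonal weight is increased by one to absorb the count of diagonal toggles.\<close>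

definition toggle_weight :: "nat \<Rightarrow> nat \<times> nat \<Rightarrow> real" where
  "toggle_weight N p = (if fst p = snd p then real N + 3 - real (fst p + snd p)
     else 2 * (real N + 2 - real (fst p + snd p)))"

section \<open>The weighted boundary identity and its use for shifted shapes\<close>

text \<open>The ambient poset is infinite, so finiteness comes from the doubled diagram: its addable
  rows are 1 and the successors of finitely many removable rows.\<close>

lemma finite_addable_shifted:
  assumes I: "I \<in> order_ideals shifted_quadrant box_le" and fin: "finite I"
  shows "finite (addable shifted_quadrant box_le I)"
proof -
  have D: "double I \<in> order_ideals quadrant box_le" "finite (double I)"
    using double_order_ideal[OF I] fin by (auto simp: double_def)
  have "finite (removable box_le (double I))"
    by (rule finite_subset[OF _ D(2)]) (auto simp: removable_def)
  then have "finite (fst ` addable quadrant box_le (double I))"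
    by (simp add: fst_addable_quadrant[OF D])
  then have "finite (addable quadrant box_le (double I))"
    using finite_imageD inj_on_fst_addable by blast
  then show ?thesis unfolding addable_double[OF I] by (simp add: double_def)
qed

text \<open>A combination of three identities: the row sums of the doubled diagram for
  \<open>f = 1\<close> and \<open>f = real\<close>, and the count of diagonal toggles. Divided by 4
  it expresses the number of removable boxes as a constant plus weighted toggle differences.\<close>

lemma sum_toggle_weight:
  assumes I: "I \<in> order_ideals shifted_quadrant box_le" and fin: "finite I"
  shows "4 * real (card (removable box_le I))
    + (\<Sum>p\<in>addable shifted_quadrant box_le I. toggle_weight N p)
    - (\<Sum>p\<in>removable box_le I. toggle_weight N p) = real N + 1"
proof -
  define A where "A = addable shifted_quadrant box_le I"
  define R where "R = removable box_le I"
  \<comment> \<open>\<open>w p\<close> counts the boxes of the doubled diagram coming from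
    \<open>p\<close>, and \<open>h p\<close> adds up their row indices; the column of
    \<open>p\<close> is the row of its mirror image.\<close>
  define w :: "nat \<times> nat \<Rightarrow> real" where "w p = (if fst p = snd p then 1 else 2)" for p
  define h :: "nat \<times> nat \<Rightarrow> real" where
    "h p = (if fst p = snd p then real (fst p) else real (fst p) + real (snd p))" for p
  define d :: "nat \<times> nat \<Rightarrow> real" where "d p = of_bool (fst p = snd p)" for p
  have finAR: "finite A" "finite R"
    using finite_addable_shifted[OF I fin] fin by (auto simp: A_def R_def removable_def)
  have sub: "A \<subseteq> shifted_quadrant" "R \<subseteq> shifted_quadrant"
    using order_ideals_subset[OF I] by (auto simp: A_def R_def addable_def removable_def)
  have row_sum: "(\<Sum>p\<in>A. if fst p = snd p then f (fst p) else f (fst p) + f (snd p))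
      = f 1 + (\<Sum>p\<in>R. if fst p = snd p then f (Suc (fst p)) else f (Suc (fst p)) + f (Suc (snd p)))"
    for f :: "nat \<Rightarrow> real"
    using sum_fst_addable_quadrant[OF double_order_ideal[OF I], of f] fin
      sum_double[OF finAR(1) sub(1), of "\<lambda>p. f (fst p)"]
      sum_double[OF finAR(2) sub(2), of "\<lambda>p. f (Suc (fst p))"]
    unfolding addable_double[OF I] removable_double[OF I] A_def[symmetric] R_def[symmetric]
    by (simp add: double_def fin cong: if_cong)
  have eq_w: "sum w A = 1 + sum w R"
    using row_sum[of "\<lambda>_. 1"] by (simp add: w_def[abs_def] cong: if_cong)
  have eq_h: "sum h A = 1 + sum h R + sum w R"
  proof -
    have "sum h A = 1 + (\<Sum>p\<in>R. h p + w p)"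
      using row_sum[of real] unfolding h_def[abs_def] w_def
      by (simp, intro sum.cong) auto
    then show ?thesis by (simp add: sum.distrib)
  qed
  have eq_d: "sum d A + sum d R = 1"
    using card_diagonal_toggles[OF I fin] finAR
    unfolding A_def[symmetric] R_def[symmetric] d_def[abs_def]
    by (simp add: Collect_conj_eq flip: of_nat_add)
  have "toggle_weight N = (\<lambda>p. (real N + 2) * w p - 2 * h p + d p)"
    by (auto simp: toggle_weight_def w_def h_def d_def)
  then have weight: "(\<Sum>p\<in>X. toggle_weight N p) = (real N + 2) * sum w X - 2 * sum h X + sum d X" for X
    by (simp add: sum.distrib sum_subtractf sum_distrib_left)
  \<comment> \<open>The identity \<open>4 = 2 * w p + 2 * d p\<close> holds for every box. The
    \<open>w\<close> part cancels against the row shift in \<open>eq_h\<close>, and the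
    \<open>d\<close> part turns a difference of diagonal counts into their sum.\<close>
  have "(\<Sum>p\<in>R. 4 :: real) = (\<Sum>p\<in>R. 2 * w p + 2 * d p)"
    by (rule sum.cong) (auto simp: w_def d_def)
  then have "4 * real (card R) = 2 * sum w R + 2 * sum d R"
    by (simp add: sum.distrib sum_distrib_left)
  with eq_w eq_h eq_d show ?thesis
    unfolding A_def[symmetric] R_def[symmetric] weight by (simp add: algebra_simps)
qed

text \<open>The certificate has coefficients \<open>toggle_weight N p / 4\<close>. The hypothesis on
  corners says that every box addable to the full shape has weight zero.\<close>

theorem tCDE_shifted_shape:
  assumes P: "P \<in> order_ideals shifted_quadrant box_le" and fin: "finite P"
    and corner: "\<And>a b. (a, b) \<in> addable shifted_quadrant box_le P \<Longrightarrow>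
      a + b = (if a = b then N + 3 else N + 2)"
  shows "tCDE P box_le"
    and "expect P box_le (uni P box_le) (\<lambda>I. real (ddeg P box_le I)) = (real N + 1) / 4"
proof -
  have "real (ddeg P box_le I) = (real N + 1) / 4 + (\<Sum>p\<in>P. toggle_weight N p / 4
      * (tog_minus P box_le p I - tog_plus P box_le p I))"
    if I: "I \<in> order_ideals P box_le" for I
  proof -
    have IP: "I \<subseteq> P" using order_ideals_subset[OF I] .
    then have finI: "finite I" using fin finite_subset by blast
    have IS: "I \<in> order_ideals shifted_quadrant box_le"
      using I P unfolding order_ideals_def by blast
    let ?A = "addable shifted_quadrant box_le I" and ?R = "removable box_le I"
    \<comment> \<open>\<open>P\<close> is down-closed in the shifted quadrant, so for boxes of
      \<open>P\<close> minimality outside \<open>I\<close> means the same in both posets.\<close>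
    have A: "addable P box_le I = P \<inter> ?A"
      using P IP unfolding order_ideals_def addable_def by blast
    have RP: "?R \<subseteq> P" using IP by (auto simp: removable_def)
    \<comment> \<open>Minimality in the complement of \<open>I\<close> passes to the smaller
      complement of \<open>P\<close>, so such a box is a corner of \<open>P\<close>.\<close>
    have outside: "toggle_weight N p = 0" if "p \<in> ?A - P" for p
    proof -
      have "p \<in> addable shifted_quadrant box_le P"
        using that IP unfolding addable_def by blast
      then have "real (fst p + snd p) = (if fst p = snd p then real N + 3 else real N + 2)"
        using corner[of "fst p" "snd p"] by auto
      then show ?thesis by (auto simp: toggle_weight_def)
    qed
    have "(\<Sum>p\<in>P. toggle_weight N p * (tog_minus P box_le p I - tog_plus P box_le p I))
        = (\<Sum>p\<in>P. if p \<in> ?R then toggle_weight N p else 0)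
          - (\<Sum>p\<in>P. if p \<in> ?A then toggle_weight N p else 0)"
      unfolding sum_subtractf[symmetric]
      by (rule sum.cong) (auto simp: tog_plus_addable tog_minus_removable A)
    also have "\<dots> = sum (toggle_weight N) (P \<inter> ?R) - sum (toggle_weight N) (P \<inter> ?A)"
      by (simp only: sum.inter_restrict[OF fin])
    also have "P \<inter> ?R = ?R" using RP by blast
    also have "sum (toggle_weight N) (P \<inter> ?A) = sum (toggle_weight N) ?A"
      using finite_addable_shifted[OF IS finI] outside
      by (intro sum.mono_neutral_left) auto
    finally have "(\<Sum>p\<in>P. toggle_weight N p * (tog_minus P box_le p I - tog_plus P box_le p I))
        = sum (toggle_weight N) ?R - sum (toggle_weight N) ?A" .
    with sum_toggle_weight[OF IS finI, of N] show ?thesis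
      unfolding ddeg_eq_card_removable[OF fin transp_box_le antisymp_box_le I]
      by (simp add: sum_divide_distrib[symmetric] field_simps)
  qed
  from tCDE_if_toggle_certificate[OF fin this]
  show "tCDE P box_le"
    and "expect P box_le (uni P box_le) (\<lambda>I. real (ddeg P box_le I)) = (real N + 1) / 4"
    by blast+
qed

section \<open>Partitions and the corners of balanced shapes\<close>

lemma is_partition_antimono:
  assumes "is_partition nu" "1 \<le> i" "i \<le> j"
  shows "nu j \<le> nu i"
  using assms(3)
proof (induction rule: dec_induct)
  case (step j)
  then have "nu (Suc j) \<le> nu j" using assms(1,2) by (simp add: is_partition_def)
  with step.IH show ?case by simp
qed simp

text \<open>The positive parts occupy an initial segment of the indices, so their number is also the
  last index with a positive part.\<close>

lemma partition_pos_iff_le_plen: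
  assumes nu: "is_partition nu" and "1 \<le> i"
  shows "0 < nu i \<longleftrightarrow> i \<le> plen nu"
proof -
  let ?S = "{i. 1 \<le> i \<and> 0 < nu i}"
  obtain M where M: "\<forall>i\<ge>M. nu i = 0" using nu by (auto simp: is_partition_def)
  have "?S \<subseteq> {..<M}" using M by (auto simp: not_less[symmetric])
  then have fin: "finite ?S" using finite_subset by blast
  show ?thesis
  proof
    assume "0 < nu i"
    then have "{1..i} \<subseteq> ?S"
      using is_partition_antimono[OF nu] by (fastforce intro: order.strict_trans2)
    from card_mono[OF fin this] show "i \<le> plen nu" by (simp add: plen_def)
  next
    assume le: "i \<le> plen nu"
    show "0 < nu i"
    proof (rule ccontr)
      assume "\<not> 0 < nu i"
      then have "nu j = 0" if "i \<le> j" for j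
        using is_partition_antimono[OF nu \<open>1 \<le> i\<close> that] by simp
      then have "?S \<subseteq> {1..<i}" by (auto intro: ccontr)
      from card_mono[OF _ this] le assms(2) show False by (simp add: plen_def)
    qed
  qed
qed

text \<open>Both families at once, with \<open>m\<close> the width of the added rectangle and
  \<open>N = n + k + m\<close>. A corner \<open>(n + 1, n + 1)\<close> appears exactly when
  \<open>m\<close> is nonzero, and its weight vanishes only if \<open>2 * n + 2 = N + 3\<close>,
  that is \<open>m = n - 1 - k\<close>.\<close>

lemma tCDE_balanced_shifted_shape:
  assumes "k < n" and bal: "balanced nu k" and m: "m = 0 \<or> m = n - 1 - k"
    and lam: "\<And>i. 1 \<le> i \<Longrightarrow> lam i = (if i \<le> n then n + 1 - i + nu i + m else 0)"
  shows "tCDE (shifted_boxes lam) box_le"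
    and "expect (shifted_boxes lam) box_le (uni (shifted_boxes lam) box_le)
      (\<lambda>I. real (ddeg (shifted_boxes lam) box_le I)) = (real (n + k + m) + 1) / 4"
proof -
  let ?P = "shifted_boxes lam"
  have nu: "is_partition nu" "plen nu = k" "nu 1 = k" using bal by (auto simp: balanced_def)
  have zero: "nu i = 0 \<longleftrightarrow> k < i" if "1 \<le> i" for i
    using partition_pos_iff_le_plen[OF nu(1) that] nu(2) by auto
  have "{i. 1 \<le> i \<and> 0 < lam i} = {1..n}" by (auto simp: lam split: if_splits)
  then have plen: "plen lam = n" by (simp add: plen_def)
  \<comment> \<open>The staircase absorbs the shift of the rows: row \<open>i\<close> ends in column
    \<open>n + m + nu i\<close>, so the right boundary is that of the straight shape
    \<open>nu\<close>.\<close>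
  have mem: "(i, j) \<in> ?P \<longleftrightarrow> 1 \<le> i \<and> i \<le> n \<and> i \<le> j \<and> j \<le> n + m + nu i" for i j
    by (auto simp: shifted_boxes_def plen lam)
  have ideal: "?P \<in> order_ideals shifted_quadrant box_le"
  proof -
    have "(i', j') \<in> ?P" if "(i, j) \<in> ?P" "1 \<le> i'" "i' \<le> i" "i' \<le> j'" "j' \<le> j" for i j i' j'
      using that is_partition_antimono[OF nu(1) that(2,3)] unfolding mem by auto
    then show ?thesis
      by (auto simp: order_ideals_def shifted_quadrant_def box_le_def mem)
  qed
  have "?P \<subseteq> {..n} \<times> {..n + m + k}"
    using is_partition_antimono[OF nu(1), of 1] nu(3) by (fastforce simp: mem)
  then have fin: "finite ?P" by (rule finite_subset) simp
  have corner: "a + b = (if a = b then n + k + m + 3 else n + k + m + 2)"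
    if "(a, b) \<in> addable shifted_quadrant box_le ?P" for a b
  proof -
    have ab: "1 \<le> a" "a \<le> b" "(a, b) \<notin> ?P" "a = 1 \<or> (a - 1, b) \<in> ?P" "a = b \<or> (a, b - 1) \<in> ?P"
      using that unfolding mem_addable_shifted[OF ideal] by auto
    show ?thesis
    proof (cases "a \<le> n")
      case True
      then have b: "b > n + m + nu a" using ab unfolding mem by auto
      with True have "a \<noteq> b" by auto
      then have b: "b = n + m + nu a + 1" using b ab(5) unfolding mem by auto
      \<comment> \<open>In row 1 this is \<open>nu 1 = k\<close>. A later corner in row
        \<open>Suc i\<close> requires a descent of \<open>nu\<close> at \<open>i\<close>;
        balancedness settles \<open>i < k\<close>, and for \<open>i = k\<close> the next part is
        0.\<close>
      have "a + nu a = k + 1"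
      proof (cases "a = 1")
        case False
        then obtain i where i: "a = Suc i" "1 \<le> i" using ab(1) by (cases a) auto
        have less: "nu (Suc i) < nu i" using ab(4) b False i unfolding mem by auto
        then have "i \<le> k" using zero[OF i(2)] by auto
        moreover have "i + nu (Suc i) = k" if "i \<noteq> k"
          using bal less i(2) that \<open>i \<le> k\<close> by (auto simp: balanced_def)
        moreover have "nu (Suc i) = 0" if "i = k" using zero[of "Suc i"] that by simp
        ultimately show ?thesis using i by fastforce
      qed (use nu(3) in simp)
      with b \<open>a \<noteq> b\<close> show ?thesis by simp
    next
      case False
      \<comment> \<open>Rows beyond \<open>n\<close> are empty, so a corner there can only be the
        first box of row \<open>n + 1\<close>, on the diagonal. The box above it lies in row
        \<open>n\<close>, which has \<open>m + 1\<close> boxes.\<close>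
      then have "a = Suc n" "b = a" using ab \<open>k < n\<close> unfolding mem by auto
      then have "(n, b) \<in> ?P" using ab(4) \<open>k < n\<close> by simp
      then have "m \<noteq> 0" using zero[of n] \<open>k < n\<close> \<open>a = Suc n\<close> \<open>b = a\<close> unfolding mem by auto
      with m \<open>a = Suc n\<close> \<open>b = a\<close> \<open>k < n\<close> show ?thesis by auto
    qed
  qed
  show "tCDE ?P box_le"
    and "expect ?P box_le (uni ?P box_le) (\<lambda>I. real (ddeg ?P box_le I)) = (real (n + k + m) + 1) / 4"
    using tCDE_shifted_shape[OF ideal fin corner] by blast+
qed

theorem theorem5p2:
  fixes n k :: nat and nu :: "nat \<Rightarrow> nat"
  assumes "k < n" and "balanced nu k"
  shows "(let lam = padd (staircase n) nu in
            tCDE (shifted_boxes lam) box_le \<and>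
            expect (shifted_boxes lam) box_le (uni (shifted_boxes lam) box_le)
              (\<lambda>I. real (ddeg (shifted_boxes lam) box_le I)) = (real n + 1 + real k) / 4)
       \<and> (let lam = padd (padd (staircase n) nu) (rect (n - 1 - k) n) in
            tCDE (shifted_boxes lam) box_le \<and>
            expect (shifted_boxes lam) box_le (uni (shifted_boxes lam) box_le)
              (\<lambda>I. real (ddeg (shifted_boxes lam) box_le I)) = real n / 2)"
proof -
  have "nu i = 0" if "\<not> i \<le> n" for i
    using partition_pos_iff_le_plen[of nu i] assms that by (auto simp: balanced_def)
  then have lam1: "padd (staircase n) nu i = (if i \<le> n then n + 1 - i + nu i + 0 else 0)"
    and lam2: "padd (padd (staircase n) nu) (rect (n - 1 - k) n) i
      = (if i \<le> n then n + 1 - i + nu i + (n - 1 - k) else 0)" if "1 \<le> i" for i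
    using that by (auto simp: padd_def staircase_def rect_def)
  \<comment> \<open>Since \<open>k < n\<close>, the subtraction \<open>n - 1 - k\<close> is not
    truncated and the second numerator is \<open>2 * n\<close>.\<close>
  have "(real (n + k + 0) + 1) / 4 = (real n + 1 + real k) / 4"
    and "(real (n + k + (n - 1 - k)) + 1) / 4 = real n / 2"
    using assms(1) by (simp_all add: of_nat_diff)
  then show ?thesis
    using tCDE_balanced_shifted_shape[OF assms disjI1[OF refl] lam1]
      tCDE_balanced_shifted_shape[OF assms disjI2[OF refl] lam2]
    by (simp add: Let_def)
qed

end
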